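(* Let $\mathcal{A}=\{(U_i,E_i,D_i)\}_{i\in I}$ be an autoencoder atlas on $M$. Its transition maps satisfy the cocycle condition: for all $i,j,k$ with $U_i\cap U_j\cap U_k\ne\emptyset$, $$T_{ki}=T_{kj}\circ T_{ji}\quad\text{on }E_i(U_i\cap U_j\cap U_k).$$
   Context: $M$ is a smooth compact $d$-dimensional manifold without boundary, embedded in $\mathbb{R}^N$. An autoencoder chart on $M$ is a triple $(U,E,D)$ where $U\subset M$ is open, $E:U\to Z\subset\mathbb{R}^d$ is continuous and injective (encoder), $D:Z\to M$ is continuous (decoder), and $D\circ E=\mathrm{Id}_U$. An autoencoder atlas on $M$ is a collection $\{(U_i,E_i,D_i)\}_{i\in I}$ of autoencoder charts such that $\{U_i\}$ covers $M$. For $U_i\cap U_j\ne\emptyset$ the transition map is $T_{ji}=E_j\circ D_i:E_i(U_i\cap U_j)\to E_j(U_i\cap U_j)$. *)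

theory Defs
  imports "HOL-Analysis.Analysis"
begin

text \<open>\<open>Ck_on k S f\<close> is meant for open \<open>S\<close>: all directional derivatives of
  \<open>f\<close> up to order \<open>k\<close> exist (with \<open>f\<close> totally differentiable at every stage
  below \<open>k\<close>) and are continuous on \<open>S\<close>.\<close>

fun Ck_on :: "nat \<Rightarrow> 'a::euclidean_space set \<Rightarrow> ('a \<Rightarrow> 'b::real_normed_vector) \<Rightarrow> bool" where
  "Ck_on 0 S f \<longleftrightarrow> continuous_on S f"
| "Ck_on (Suc k) S f \<longleftrightarrow>
     f differentiable_on S \<and> (\<forall>v. Ck_on k S (\<lambda>x. frechet_derivative f (at x) v))"

definition smooth_on :: "'a::euclidean_space set \<Rightarrow> ('a \<Rightarrow> 'b::real_normed_vector) \<Rightarrow> bool" where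
  "smooth_on S f \<longleftrightarrow> (\<forall>k. Ck_on k S f)"

definition diffeomorphism_between ::
  "'a::euclidean_space set \<Rightarrow> 'b::euclidean_space set \<Rightarrow> ('a \<Rightarrow> 'b) \<Rightarrow> ('b \<Rightarrow> 'a) \<Rightarrow> bool" where
  "diffeomorphism_between S T f g \<longleftrightarrow>
     homeomorphism S T f g \<and> smooth_on S f \<and> smooth_on T g"

text \<open>A smooth embedded submanifold of dimension \<open>d\<close>, without boundary, given by slice
  charts: near each of its points it is straightened by an ambient diffeomorphism to an open
  piece of a \<open>d\<close>-dimensional linear subspace.\<close>

definition smooth_submanifold :: "nat \<Rightarrow> 'a::euclidean_space set \<Rightarrow> bool" where
  "smooth_submanifold d M \<longleftrightarrow>
     (\<forall>p\<in>M. \<exists>V W L \<phi> \<psi>.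
        open V \<and> p \<in> V \<and> open W \<and> subspace (L :: 'a set) \<and> dim L = d \<and>
        diffeomorphism_between V W \<phi> \<psi> \<and> \<phi> ` (V \<inter> M) = W \<inter> L)"

text \<open>\<open>\<real>\<^sup>d\<close>, for a natural number \<open>d\<close> (possibly 0), is the topological space
  \<^term>\<open>Euclidean_space d\<close>, whose points are the sequences vanishing from index \<open>d\<close> on.
  The latent set \<open>Z\<close> is recorded explicitly; it may be larger than \<open>E(U)\<close>.
  The values of the encoder outside \<open>U\<close> and of the decoder outside \<open>Z\<close> carry no meaning.\<close>

record 'a autoencoder =
  chart_dom :: "'a set"
  latent :: "(nat \<Rightarrow> real) set"
  encoder :: "'a \<Rightarrow> nat \<Rightarrow> real"
  decoder :: "(nat \<Rightarrow> real) \<Rightarrow> 'a"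

definition autoencoder_chart ::
  "nat \<Rightarrow> 'a::topological_space set \<Rightarrow> 'a autoencoder \<Rightarrow> bool" where
  "autoencoder_chart d M c \<longleftrightarrow>
     openin (top_of_set M) (chart_dom c) \<and>
     latent c \<subseteq> topspace (Euclidean_space d) \<and>
     continuous_map (top_of_set (chart_dom c)) (subtopology (Euclidean_space d) (latent c))
       (encoder c) \<and>
     inj_on (encoder c) (chart_dom c) \<and>
     continuous_map (subtopology (Euclidean_space d) (latent c)) (top_of_set M) (decoder c) \<and>
     (\<forall>x\<in>chart_dom c. decoder c (encoder c x) = x)"

definition autoencoder_atlas ::
  "nat \<Rightarrow> 'a::topological_space set \<Rightarrow> 'i set \<Rightarrow> ('i \<Rightarrow> 'a autoencoder) \<Rightarrow> bool" where
  "autoencoder_atlas d M I A \<longleftrightarrow>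
     (\<forall>i\<in>I. autoencoder_chart d M (A i)) \<and> (\<Union>i\<in>I. chart_dom (A i)) = M"

text \<open>\<open>transition_map A j i\<close> is \<open>T\<^sub>j\<^sub>i\<close>, from chart \<open>i\<close> to chart \<open>j\<close>; it is
  \<^const>\<open>undefined\<close> outside \<open>E\<^sub>i(U\<^sub>i \<inter> U\<^sub>j)\<close>.\<close>

definition transition_map ::
  "('i \<Rightarrow> 'a autoencoder) \<Rightarrow> 'i \<Rightarrow> 'i \<Rightarrow> (nat \<Rightarrow> real) \<Rightarrow> (nat \<Rightarrow> real)" where
  "transition_map A j i =
     restrict (encoder (A j) \<circ> decoder (A i))
       (encoder (A i) ` (chart_dom (A i) \<inter> chart_dom (A j)))"

end

theory Submission
  imports Defs
begin

text \<open>A transition map only changes the code of a point: \<open>T_ji\<close> sends the code of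
  \<open>x\<close> in chart \<open>i\<close> to the code of the same \<open>x\<close> in chart
  \<open>j\<close>, as \<open>transition_map_encoder\<close> records. Over a point \<open>x\<close>
  of the triple overlap, going from \<open>i\<close> to \<open>k\<close> directly or through
  \<open>j\<close> therefore ends at the same code \<open>encoder (A k) x\<close>.\<close>

text \<open>The decoder inverts the encoder on the chart domain, and \<open>x\<close> lying in both
  domains puts its code where \<open>restrict\<close> does not yield
  \<open>undefined\<close>.\<close>

lemma transition_map_encoder:
  assumes "autoencoder_chart d M (A i)"
    and "x \<in> chart_dom (A i) \<inter> chart_dom (A j)"
  shows "transition_map A j i (encoder (A i) x) = encoder (A j) x"
  using assms by (auto simp: transition_map_def autoencoder_chart_def)

theorem lemma3p9:
  fixes M :: "(real ^ 'N) set"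
    and d :: nat
    and I :: "'i set"
    and A :: "'i \<Rightarrow> (real ^ 'N) autoencoder"
  assumes "compact M"
    and "smooth_submanifold d M"
    and "autoencoder_atlas d M I A"
  shows "\<forall>i\<in>I. \<forall>j\<in>I. \<forall>k\<in>I.
    chart_dom (A i) \<inter> chart_dom (A j) \<inter> chart_dom (A k) \<noteq> {} \<longrightarrow>
    (\<forall>z \<in> encoder (A i) ` (chart_dom (A i) \<inter> chart_dom (A j) \<inter> chart_dom (A k)).
       transition_map A k i z = (transition_map A k j \<circ> transition_map A j i) z)"
proof (intro ballI impI)
  fix i j k z
  assume "i \<in> I" "j \<in> I"
    and "z \<in> encoder (A i) ` (chart_dom (A i) \<inter> chart_dom (A j) \<inter> chart_dom (A k))"
  then obtain x where x: "x \<in> chart_dom (A i)" "x \<in> chart_dom (A j)" "x \<in> chart_dom (A k)"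
    and z: "z = encoder (A i) x"
    by blast
  \<comment> \<open>The decoders applied are those of \<open>i\<close> and \<open>j\<close>, so
    these two charts supply the inverse law.\<close>
  have "autoencoder_chart d M (A i)" "autoencoder_chart d M (A j)"
    using assms(3) \<open>i \<in> I\<close> \<open>j \<in> I\<close> by (auto simp: autoencoder_atlas_def)
  then show "transition_map A k i z = (transition_map A k j \<circ> transition_map A j i) z"
    using x by (simp add: z transition_map_encoder)
qed

end
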